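(* Let $f\colon\Omega\to\mathbb{R}$ be a local function. Then for all $N$ large enough and all $\sigma\in\Omega_N$, $$\frac{1}{|\mathbb{T}_N^d|}\,e^{-|\mathbb{T}_N^d|\langle f,\mathcal{L}_N(\sigma)\rangle}\,L_N\!\left(e^{|\mathbb{T}_N^d|\langle f,\mathcal{L}_N\rangle}\right)(\sigma)=\left\langle c\left(e^{\mathcal{D}_N f}-1\right),\mathcal{L}_N(\sigma)\right\rangle,$$ where $\mathcal{D}_N$ is the linear operator acting on functions on $\Omega_N$ defined by $$\mathcal{D}_N 1=0,\qquad \mathcal{D}_N H_A=\sum_{r\in -A}(-2)\,H_{A+r}\quad\text{for } A\subseteq\mathbb{T}_N^d,$$ with $-A=\{-a: a\in A\}$, $A+r=\{a+r: a\in A\}$, and all additions in $\mathbb{T}_N^d$ taken coordinate-wise modulo $2N+1$.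
   Context: Let $d\ge 1$. For $N\in\mathbb{N}$ let $\mathbb{T}_N^d=(\mathbb{Z}/(2N+1)\mathbb{Z})^d$ be the $d$-dimensional torus, identified with $\Lambda_N^d=([-N,N]\cap\mathbb{Z})^d$, and let $|\mathbb{T}_N^d|=(2N+1)^d$ be its cardinality. Let $\Omega_N=\{-1,1\}^{\mathbb{T}_N^d}$ and $\Omega=\{-1,1\}^{\mathbb{Z}^d}$. A function $f\colon\Omega\to\mathbb{R}$ is local if it depends on only finitely many coordinates $\sigma_j$, $j\in\mathbb{Z}^d$; when $\Lambda_N^d$ contains the dependence set of $f$ (which holds for $N$ large enough), $f$ is also viewed as a function on $\Omega_N$ via the identification of $\mathbb{T}_N^d$ with $\Lambda_N^d$. For $\sigma\in\Omega_N$ and $i\in\mathbb{T}_N^d$, the shift is $(\tau_i\sigma)_j=\sigma_{i+j}$ (addition modulo $2N+1$), and $\sigma^i$ is the configuration obtained from $\sigma$ by flipping the spin at site $i$. For finite $A$, $H_A(\sigma)=\prod_{i\in A}\sigma_i$ (with $H_\emptyset=1$); the functions $H_A$, $A\subseteq\mathbb{T}_N^d$, form a basis of the space of real functions on $\Omega_N$. The spin-flip rates are given by a strictly positive local function $c\colon\Omega\to(0,\infty)$ (viewed as a function on $\Omega_N$ for $N$ large), with translation-invariant rates $c_i(\sigma)=c(\tau_i\sigma)$. The generator $L_N$ acts on functions $g\colon\Omega_N\to\mathbb{R}$ by $$(L_N g)(\sigma)=\sum_{i\in\mathbb{T}_N^d}c_i(\sigma)\,[g(\sigma^i)-g(\sigma)].$$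 The empirical measure of $\sigma\in\Omega_N$ is $\mathcal{L}_N(\sigma)=\frac{1}{|\mathbb{T}_N^d|}\sum_{i\in\mathbb{T}_N^d}\delta_{\tau_i\sigma}$, a probability measure on $\Omega_N$, and $\langle g,\mathcal{L}_N(\sigma)\rangle=\int g\,d\mathcal{L}_N(\sigma)=\frac{1}{|\mathbb{T}_N^d|}\sum_{i\in\mathbb{T}_N^d}g(\tau_i\sigma)$ for $g\colon\Omega_N\to\mathbb{R}$. The expression $e^{|\mathbb{T}_N^d|\langle f,\mathcal{L}_N\rangle}$ denotes the function $\sigma\mapsto e^{|\mathbb{T}_N^d|\langle f,\mathcal{L}_N(\sigma)\rangle}$ on $\Omega_N$. *)

theory Defs
  imports "HOL-Probability.Probability"
begin

(* The lattice Z^d is the type int ^ 'd, with d = CARD('d) >= 1.  Spins are the real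
   numbers 1 and -1. *)

definition Omega :: "(int ^ 'd \<Rightarrow> real) set" where
  "Omega = {\<sigma>. \<forall>i. \<sigma> i \<in> {-1, 1}}"

definition is_local :: "((int ^ 'd \<Rightarrow> real) \<Rightarrow> real) \<Rightarrow> bool" where
  "is_local f \<longleftrightarrow> (\<exists>S. finite S \<and>
     (\<forall>\<sigma>\<in>Omega. \<forall>\<eta>\<in>Omega. (\<forall>j\<in>S. \<sigma> j = \<eta> j) \<longrightarrow> f \<sigma> = f \<eta>))"

(* The torus (Z/(2N+1)Z)^d is represented by the box [-N,N]^d, so its group operation
   is addition followed by reduction to the representative in the box.  The box is
   closed under the ordinary negation, which therefore is the negation of the torus. *)

definition torus :: "nat \<Rightarrow> (int ^ 'd) set" where
  "torus N = {x. \<forall>k. x $ k \<in> {- int N..int N}}"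

definition tadd :: "nat \<Rightarrow> int ^ 'd \<Rightarrow> int ^ 'd \<Rightarrow> int ^ 'd" where
  "tadd N x y = (\<chi> k. (x $ k + y $ k + int N) mod (2 * int N + 1) - int N)"

definition OmegaN :: "nat \<Rightarrow> (int ^ 'd \<Rightarrow> real) set" where
  "OmegaN N = torus N \<rightarrow>\<^sub>E {-1, 1}"

(* Real functions on OmegaN N are the elements of extensional (OmegaN N), so that
   equality of functions on OmegaN N is equality in HOL. *)

abbreviation funsN :: "nat \<Rightarrow> ((int ^ 'd \<Rightarrow> real) \<Rightarrow> real) set" where
  "funsN N \<equiv> extensional (OmegaN N)"

(* A local function viewed on OmegaN N.  Outside the box the configuration is continued
   by 1; if the box contains the dependence set of f, any other continuation gives the
   same function. *)

definition on_torus ::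
  "nat \<Rightarrow> ((int ^ 'd \<Rightarrow> real) \<Rightarrow> real) \<Rightarrow> (int ^ 'd \<Rightarrow> real) \<Rightarrow> real" where
  "on_torus N f = (\<lambda>\<sigma>\<in>OmegaN N. f (\<lambda>j. if j \<in> torus N then \<sigma> j else 1))"

definition tshift :: "nat \<Rightarrow> int ^ 'd \<Rightarrow> (int ^ 'd \<Rightarrow> real) \<Rightarrow> int ^ 'd \<Rightarrow> real" where
  "tshift N i \<sigma> = (\<lambda>j\<in>torus N. \<sigma> (tadd N i j))"

definition flip :: "int ^ 'd \<Rightarrow> (int ^ 'd \<Rightarrow> real) \<Rightarrow> int ^ 'd \<Rightarrow> real" where
  "flip i \<sigma> = \<sigma>(i := - \<sigma> i)"

definition generator ::
  "((int ^ 'd \<Rightarrow> real) \<Rightarrow> real) \<Rightarrow> nat \<Rightarrow>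
   ((int ^ 'd \<Rightarrow> real) \<Rightarrow> real) \<Rightarrow> (int ^ 'd \<Rightarrow> real) \<Rightarrow> real" where
  "generator c N g = (\<lambda>\<sigma>\<in>OmegaN N.
     \<Sum>i\<in>torus N. on_torus N c (tshift N i \<sigma>) * (g (flip i \<sigma>) - g \<sigma>))"

(* The average of the point masses at the shifts of \<sigma>, as the image of the uniform
   distribution on the torus. *)

definition empirical :: "nat \<Rightarrow> (int ^ 'd \<Rightarrow> real) \<Rightarrow> (int ^ 'd \<Rightarrow> real) pmf" where
  "empirical N \<sigma> = map_pmf (\<lambda>i. tshift N i \<sigma>) (pmf_of_set (torus N))"

definition pairing ::
  "((int ^ 'd \<Rightarrow> real) \<Rightarrow> real) \<Rightarrow> (int ^ 'd \<Rightarrow> real) pmf \<Rightarrow> real" where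
  "pairing g \<mu> = measure_pmf.expectation \<mu> g"

definition H :: "nat \<Rightarrow> (int ^ 'd) set \<Rightarrow> (int ^ 'd \<Rightarrow> real) \<Rightarrow> real" where
  "H N A = (\<lambda>\<sigma>\<in>OmegaN N. \<Prod>i\<in>A. \<sigma> i)"

definition linear_op ::
  "nat \<Rightarrow> (((int ^ 'd \<Rightarrow> real) \<Rightarrow> real) \<Rightarrow> ((int ^ 'd \<Rightarrow> real) \<Rightarrow> real)) \<Rightarrow> bool" where
  "linear_op N D \<longleftrightarrow> D \<in> funsN N \<rightarrow>\<^sub>E funsN N \<and>
     (\<forall>g\<in>funsN N. \<forall>h\<in>funsN N.
        D (\<lambda>\<sigma>\<in>OmegaN N. g \<sigma> + h \<sigma>) = (\<lambda>\<sigma>\<in>OmegaN N. D g \<sigma> + D h \<sigma>)) \<and>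
     (\<forall>a. \<forall>g\<in>funsN N. D (\<lambda>\<sigma>\<in>OmegaN N. a * g \<sigma>) = (\<lambda>\<sigma>\<in>OmegaN N. a * D g \<sigma>))"

definition is_D_op ::
  "nat \<Rightarrow> (((int ^ 'd \<Rightarrow> real) \<Rightarrow> real) \<Rightarrow> ((int ^ 'd \<Rightarrow> real) \<Rightarrow> real)) \<Rightarrow> bool" where
  "is_D_op N D \<longleftrightarrow> linear_op N D \<and>
     D (\<lambda>\<sigma>\<in>OmegaN N. 1) = (\<lambda>\<sigma>\<in>OmegaN N. 0) \<and>
     (\<forall>A\<subseteq>torus N. D (H N A) =
        (\<lambda>\<sigma>\<in>OmegaN N. \<Sum>r\<in>uminus ` A. (-2) * H N ((\<lambda>a. tadd N a r) ` A) \<sigma>))"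

(* Unique existence is lemma D_op_ex1 below. *)

definition D_op ::
  "nat \<Rightarrow> ((int ^ 'd \<Rightarrow> real) \<Rightarrow> real) \<Rightarrow> (int ^ 'd \<Rightarrow> real) \<Rightarrow> real" where
  "D_op N = (THE D. is_D_op N D)"

lemma zero_in_torus: "0 \<in> torus N"
  by (simp add: torus_def)

lemma finite_torus: "finite (torus N :: (int ^ 'd) set)"
proof -
  have "finite (vec_nth ` (torus N :: (int ^ 'd) set))"
    by (rule finite_subset[of _ "UNIV \<rightarrow>\<^sub>E {- int N..int N}"])
       (auto simp: torus_def intro!: finite_PiE)
  thus ?thesis
    by (rule finite_imageD) (auto simp: inj_on_def vec_eq_iff)
qed

lemma finite_OmegaN: "finite (OmegaN N :: (int ^ 'd \<Rightarrow> real) set)"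
  unfolding OmegaN_def by (intro finite_PiE finite_torus) auto

lemma tadd_commute: "tadd N x y = tadd N y x"
  by (simp add: tadd_def add.commute)

lemma tadd_in_torus: "tadd N x y \<in> torus N"
proof -
  have "0 \<le> a mod (2 * int N + 1) \<and> a mod (2 * int N + 1) < 2 * int N + 1" for a
    using pos_mod_bound[of "2 * int N + 1" a] pos_mod_sign[of "2 * int N + 1" a] by linarith
  hence "- int N \<le> a mod (2 * int N + 1) - int N \<and> a mod (2 * int N + 1) - int N \<le> int N" for a
    by (smt (verit))
  thus ?thesis by (simp add: tadd_def torus_def)
qed

lemma tadd_inj_on: "inj_on (\<lambda>a. tadd N a (r :: int ^ 'd)) (torus N)"
proof (rule inj_onI)
  fix x y :: "int ^ 'd" assume x: "x \<in> torus N" and y: "y \<in> torus N"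
    and eq: "tadd N x r = tadd N y r"
  have "x $ k = y $ k" for k
  proof -
    have "(x $ k + r $ k + int N) mod (2 * int N + 1) = (y $ k + r $ k + int N) mod (2 * int N + 1)"
      using eq by (simp add: tadd_def vec_eq_iff)
    hence "(2 * int N + 1) dvd (x $ k - y $ k)"
      by (simp add: mod_eq_dvd_iff)
    moreover have "\<bar>x $ k - y $ k\<bar> < 2 * int N + 1"
      using x y by (auto simp: torus_def abs_if) (smt (verit))+
    ultimately show ?thesis
      using zdvd_not_zless[of "\<bar>x $ k - y $ k\<bar>" "2 * int N + 1"] by fastforce
  qed
  thus "x = y" by (simp add: vec_eq_iff)
qed

lemma tadd_uminus: "tadd N a (- a) = 0"
  by (simp add: tadd_def vec_eq_iff)

lemma uminus_torus: "a \<in> torus N \<Longrightarrow> - a \<in> torus N"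
  by (auto simp: torus_def) (smt (verit))+

lemma tadd_eq_0_iff: "a \<in> torus N \<Longrightarrow> i \<in> torus N \<Longrightarrow> tadd N i a = 0 \<longleftrightarrow> i = - a"
  using inj_onD[OF tadd_inj_on, of N i a "- a"] tadd_uminus tadd_commute uminus_torus
  by metis

lemma flip_OmegaN: "i \<in> torus N \<Longrightarrow> \<sigma> \<in> OmegaN N \<Longrightarrow> flip i \<sigma> \<in> OmegaN N"
  by (fastforce simp: flip_def OmegaN_def PiE_iff extensional_def)

lemma tshift_OmegaN: "\<sigma> \<in> OmegaN N \<Longrightarrow> tshift N i \<sigma> \<in> OmegaN N"
  using tadd_in_torus by (auto simp: tshift_def OmegaN_def PiE_iff)

lemma pairing_empirical:
  fixes \<sigma> :: "int ^ 'd \<Rightarrow> real"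
  shows "pairing g (empirical N \<sigma>) =
    1 / real (card (torus N :: (int ^ 'd) set)) * (\<Sum>i\<in>torus N. g (tshift N i \<sigma>))"
proof -
  have "torus N \<noteq> ({} :: (int ^ 'd) set)" using zero_in_torus by blast
  thus ?thesis
    by (simp add: pairing_def empirical_def integral_pmf_of_set[OF _ finite_torus])
qed

lemma H_apply: "\<sigma> \<in> OmegaN N \<Longrightarrow> H N A \<sigma> = (\<Prod>i\<in>A. \<sigma> i)"
  by (simp add: H_def)

lemma H_in_funsN: "H N A \<in> funsN N"
  by (simp add: H_def)

lemma tshift_apply: "j \<in> torus N \<Longrightarrow> tshift N i \<sigma> j = \<sigma> (tadd N i j)"
  by (simp add: tshift_def)

lemma D_op_ex: "\<exists>D. is_D_op N (D :: ((int ^ 'd \<Rightarrow> real) \<Rightarrow> real) \<Rightarrow> _)"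
proof -
  let ?T = "torus N :: (int ^ 'd) set"
  define E where "E g \<sigma> = (\<Sum>i\<in>?T. g (tshift N i (flip 0 \<sigma>)) - g (tshift N i \<sigma>))"
    for g :: "(int ^ 'd \<Rightarrow> real) \<Rightarrow> real" and \<sigma>
  define D where "D = (\<lambda>g\<in>funsN N. \<lambda>\<sigma>\<in>OmegaN N. E g \<sigma>)"
  note mem = tshift_OmegaN flip_OmegaN[OF zero_in_torus]
  have HA: "E (H N A) \<sigma> = (\<Sum>r\<in>uminus ` A. (-2) * H N ((\<lambda>a. tadd N a r) ` A) \<sigma>)"
    if A: "A \<subseteq> ?T" and s: "\<sigma> \<in> OmegaN N" for A \<sigma>
  proof -
    have fA: "finite A" using A finite_torus finite_subset by blast
    have H1: "H N A (tshift N i \<sigma>) = H N ((\<lambda>a. tadd N a i) ` A) \<sigma>" for i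
    proof -
      have "H N A (tshift N i \<sigma>) = (\<Prod>a\<in>A. \<sigma> (tadd N a i))"
        unfolding H_apply[OF mem(1)[OF s]]
        by (rule prod.cong) (use A tshift_apply tadd_commute in \<open>metis subsetD\<close>)+
      also have "\<dots> = H N ((\<lambda>a. tadd N a i) ` A) \<sigma>"
        unfolding H_apply[OF s]
        by (simp add: prod.reindex[OF inj_on_subset[OF tadd_inj_on A]])
      finally show ?thesis .
    qed
    have H2: "H N A (tshift N i (flip 0 \<sigma>)) =
        (if i \<in> uminus ` A then - 1 else 1) * H N A (tshift N i \<sigma>)" if i: "i \<in> ?T" for i
    proof -
      have "H N A (tshift N i (flip 0 \<sigma>)) = (\<Prod>a\<in>A. (if a = - i then - 1 else 1) * \<sigma> (tadd N i a))"
        unfolding H_apply[OF mem(1)[OF mem(2)[OF s]]]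
      proof (rule prod.cong[OF refl])
        fix a assume "a \<in> A"
        hence a: "a \<in> ?T" using A by blast
        have "tadd N i a = 0 \<longleftrightarrow> a = - i" using tadd_eq_0_iff[OF a i] by auto
        thus "tshift N i (flip 0 \<sigma>) a = (if a = - i then - 1 else 1) * \<sigma> (tadd N i a)"
          by (auto simp: tshift_apply[OF a] flip_def)
      qed
      also have "\<dots> = (\<Prod>a\<in>A. if a = - i then - 1 else 1) * H N A (tshift N i \<sigma>)"
        using A unfolding prod.distrib H_apply[OF mem(1)[OF s]]
        by (auto simp: tshift_apply subset_iff intro!: prod.cong)
      also have "(\<Prod>a\<in>A. if a = - i then - 1 else (1::real)) = (if - i \<in> A then - 1 else 1)"
        using fA by (simp add: prod.delta)
      also have "- i \<in> A \<longleftrightarrow> i \<in> uminus ` A" by (metis image_iff minus_minus)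
      finally show ?thesis .
    qed
    have "E (H N A) \<sigma> = (\<Sum>i\<in>?T. if i \<in> uminus ` A then (-2) * H N A (tshift N i \<sigma>) else 0)"
      unfolding E_def by (rule sum.cong) (auto simp: H2)
    also have "\<dots> = (\<Sum>i\<in>?T \<inter> uminus ` A. (-2) * H N A (tshift N i \<sigma>))"
      by (rule sum.inter_restrict[OF finite_torus, symmetric])
    also have "?T \<inter> uminus ` A = uminus ` A" using A uminus_torus by auto
    finally show ?thesis by (simp add: H1)
  qed
  have lin: "linear_op N D"
    unfolding linear_op_def
  proof (intro conjI ballI allI)
    show "D \<in> funsN N \<rightarrow>\<^sub>E funsN N" by (auto simp: D_def)
    show "D (\<lambda>\<sigma>\<in>OmegaN N. g \<sigma> + h \<sigma>) = (\<lambda>\<sigma>\<in>OmegaN N. D g \<sigma> + D h \<sigma>)"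
      if "g \<in> funsN N" "h \<in> funsN N" for g h
      using that
      by (auto simp: D_def E_def mem sum.distrib[symmetric] intro!: restrict_ext sum.cong)
    show "D (\<lambda>\<sigma>\<in>OmegaN N. a * g \<sigma>) = (\<lambda>\<sigma>\<in>OmegaN N. a * D g \<sigma>)"
      if "g \<in> funsN N" for a g
      using that
      by (auto simp: D_def E_def mem sum_distrib_left right_diff_distrib
          intro!: restrict_ext sum.cong)
  qed
  have "is_D_op N D"
    unfolding is_D_op_def
  proof (intro conjI allI impI lin)
    show "D (\<lambda>\<sigma>\<in>OmegaN N. 1) = (\<lambda>\<sigma>\<in>OmegaN N. 0)"
      by (auto simp: D_def E_def mem intro!: restrict_ext)
    show "D (H N A) = (\<lambda>\<sigma>\<in>OmegaN N. \<Sum>r\<in>uminus ` A. (-2) * H N ((\<lambda>a. tadd N a r) ` A) \<sigma>)"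
      if "A \<subseteq> ?T" for A
      using HA[OF that] by (auto simp: D_def H_in_funsN intro!: restrict_ext)
  qed
  thus ?thesis by blast
qed

lemma H_span:
  fixes g :: "(int ^ 'd \<Rightarrow> real) \<Rightarrow> real"
  assumes "g \<in> funsN N"
  obtains b where "g = (\<lambda>\<sigma>\<in>OmegaN N. \<Sum>A\<in>Pow (torus N). b A * H N A \<sigma>)"
proof -
  let ?T = "torus N :: (int ^ 'd) set"
  let ?O = "OmegaN N :: (int ^ 'd \<Rightarrow> real) set"
  have orth: "(\<Sum>A\<in>Pow ?T. H N A \<eta> * H N A \<sigma>) = (if \<eta> = \<sigma> then 2 ^ card ?T else 0)"
    if "\<eta> \<in> ?O" "\<sigma> \<in> ?O" for \<eta> \<sigma>
  proof -
    have "(\<Sum>A\<in>Pow ?T. H N A \<eta> * H N A \<sigma>) = (\<Prod>i\<in>?T. \<eta> i * \<sigma> i + 1)"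
      using that by (simp add: prod_add[OF finite_torus] H_def prod.distrib)
    also have "\<dots> = (if \<eta> = \<sigma> then 2 ^ card ?T else 0)"
    proof (cases "\<eta> = \<sigma>")
      case True
      have "(\<Prod>i\<in>?T. \<eta> i * \<sigma> i + 1) = (\<Prod>i\<in>?T. 2)"
        using that True by (intro prod.cong) (auto simp: OmegaN_def PiE_iff)
      thus ?thesis using True by simp
    next
      case False
      have "\<exists>i\<in>?T. \<eta> i \<noteq> \<sigma> i"
      proof (rule ccontr)
        assume "\<not> (\<exists>i\<in>?T. \<eta> i \<noteq> \<sigma> i)"
        hence "\<eta> = \<sigma>"
          by (intro PiE_ext[OF that[unfolded OmegaN_def]]) simp
        with False show False by contradiction
      qed
      then obtain i where i: "i \<in> ?T" "\<eta> i \<noteq> \<sigma> i"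
        by (elim bexE)
      moreover have "\<eta> i \<in> {-1, 1}" "\<sigma> i \<in> {-1, 1}"
        using that i by (auto simp: OmegaN_def PiE_iff)
      ultimately have "\<eta> i * \<sigma> i + 1 = 0" by auto
      thus ?thesis using False i by (auto simp: prod_zero_iff[OF finite_torus])
    qed
    finally show ?thesis .
  qed
  define b where "b A = (\<Sum>\<eta>\<in>?O. g \<eta> * H N A \<eta>) / 2 ^ card ?T" for A
  have "(\<Sum>A\<in>Pow ?T. b A * H N A \<sigma>) = g \<sigma>" if s: "\<sigma> \<in> ?O" for \<sigma>
  proof -
    have "(\<Sum>A\<in>Pow ?T. b A * H N A \<sigma>) =
        (\<Sum>A\<in>Pow ?T. \<Sum>\<eta>\<in>?O. g \<eta> / 2 ^ card ?T * (H N A \<eta> * H N A \<sigma>))"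
      unfolding b_def sum_divide_distrib sum_distrib_right
      by (intro sum.cong refl) simp
    also have "\<dots> = (\<Sum>\<eta>\<in>?O. g \<eta> / 2 ^ card ?T * (\<Sum>A\<in>Pow ?T. H N A \<eta> * H N A \<sigma>))"
      by (subst sum.swap) (simp add: sum_distrib_left)
    also have "\<dots> = (\<Sum>\<eta>\<in>?O. if \<eta> = \<sigma> then g \<eta> else 0)"
      using s by (intro sum.cong) (auto simp: orth)
    also have "\<dots> = g \<sigma>" using s by (simp add: sum.delta[OF finite_OmegaN])
    finally show ?thesis .
  qed
  hence "g = (\<lambda>\<sigma>\<in>?O. \<Sum>A\<in>Pow ?T. b A * H N A \<sigma>)"
    using assms by (intro ext) (auto simp: restrict_def extensional_def)
  thus thesis by (rule that)
qed

lemma linear_op_sum: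
  fixes D :: "((int ^ 'd \<Rightarrow> real) \<Rightarrow> real) \<Rightarrow> _"
  assumes D: "linear_op N D" and fin: "finite S" and F: "\<And>x. x \<in> S \<Longrightarrow> F x \<in> funsN N"
  shows "D (\<lambda>\<sigma>\<in>OmegaN N. \<Sum>x\<in>S. b x * F x \<sigma>) = (\<lambda>\<sigma>\<in>OmegaN N. \<Sum>x\<in>S. b x * D (F x) \<sigma>)"
  using fin F
proof (induction S rule: finite_induct)
  case empty
  have "D (\<lambda>\<sigma>\<in>OmegaN N. 0 * restrict (\<lambda>_. 0) (OmegaN N) \<sigma>) =
      (\<lambda>\<sigma>\<in>OmegaN N. 0 * D (restrict (\<lambda>_. 0) (OmegaN N)) \<sigma>)"
    using D unfolding linear_op_def by blast
  thus ?case by (simp only: mult_zero_left sum.empty)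
next
  case (insert x S)
  have scale: "D (\<lambda>\<sigma>\<in>OmegaN N. b x * F x \<sigma>) = (\<lambda>\<sigma>\<in>OmegaN N. b x * D (F x) \<sigma>)"
    using D insert.prems unfolding linear_op_def by blast
  have IH: "D (\<lambda>\<sigma>\<in>OmegaN N. \<Sum>x\<in>S. b x * F x \<sigma>) =
      (\<lambda>\<sigma>\<in>OmegaN N. \<Sum>x\<in>S. b x * D (F x) \<sigma>)"
    using insert.IH insert.prems by blast
  have "D (\<lambda>\<sigma>\<in>OmegaN N. restrict (\<lambda>\<sigma>. b x * F x \<sigma>) (OmegaN N) \<sigma> +
        restrict (\<lambda>\<sigma>. \<Sum>x\<in>S. b x * F x \<sigma>) (OmegaN N) \<sigma>) =
      (\<lambda>\<sigma>\<in>OmegaN N. D (restrict (\<lambda>\<sigma>. b x * F x \<sigma>) (OmegaN N)) \<sigma> +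
        D (restrict (\<lambda>\<sigma>. \<Sum>x\<in>S. b x * F x \<sigma>) (OmegaN N)) \<sigma>)"
    using D unfolding linear_op_def by blast
  also have "\<dots> = (\<lambda>\<sigma>\<in>OmegaN N. \<Sum>x\<in>insert x S. b x * D (F x) \<sigma>)"
    unfolding scale IH using insert.hyps by (intro restrict_ext) simp
  also have "(\<lambda>\<sigma>\<in>OmegaN N. restrict (\<lambda>\<sigma>. b x * F x \<sigma>) (OmegaN N) \<sigma> +
        restrict (\<lambda>\<sigma>. \<Sum>x\<in>S. b x * F x \<sigma>) (OmegaN N) \<sigma>) =
      (\<lambda>\<sigma>\<in>OmegaN N. \<Sum>x\<in>insert x S. b x * F x \<sigma>)"
    using insert.hyps by (intro restrict_ext) simp
  finally show ?case .
qed

lemma D_op_ex1: "\<exists>!D. is_D_op N (D :: ((int ^ 'd \<Rightarrow> real) \<Rightarrow> real) \<Rightarrow> _)"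
proof (rule ex_ex1I[OF D_op_ex])
  fix D D' :: "((int ^ 'd \<Rightarrow> real) \<Rightarrow> real) \<Rightarrow> (int ^ 'd \<Rightarrow> real) \<Rightarrow> real"
  assume D: "is_D_op N D" and D': "is_D_op N D'"
  have lin: "linear_op N D" "linear_op N D'" using D D' by (auto simp: is_D_op_def)
  have "D g = D' g" if g: "g \<in> funsN N" for g
  proof -
    obtain b where b: "g = (\<lambda>\<sigma>\<in>OmegaN N. \<Sum>A\<in>Pow (torus N). b A * H N A \<sigma>)"
      using H_span[OF g] .
    have eq: "D (H N A) = D' (H N A)" if "A \<in> Pow (torus N)" for A
      using D D' that by (simp add: is_D_op_def)
    have fin: "finite (Pow (torus N :: (int ^ 'd) set))" using finite_torus by simp
    show ?thesis
      unfolding b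
      unfolding linear_op_sum[OF lin(1) fin H_in_funsN] linear_op_sum[OF lin(2) fin H_in_funsN]
      by (intro restrict_ext sum.cong) (auto simp: eq)
  qed
  moreover have "D \<in> extensional (funsN N)" "D' \<in> extensional (funsN N)"
    using lin by (auto simp: linear_op_def PiE_iff)
  ultimately show "D = D'" by (rule extensionalityI[rotated 2])
qed

lemma is_D_op_D_op: "is_D_op N (D_op N)"
  unfolding D_op_def by (rule theI'[OF D_op_ex1])

end

theory Submission
  imports Defs
begin

text \<open>
  Write \<open>S g \<eta>\<close> for the sum of \<open>g\<close> over all shifts of \<open>\<eta>\<close>, which is the exponent
  \<open>card (torus N) * pairing g (empirical N \<eta>)\<close>.  Factoring \<open>exp (S f \<sigma>)\<close> out of each summand
  of the generator leaves the terms \<open>c (\<tau>\<^sub>i \<sigma>) * (exp (S f (\<sigma>\<^sup>i) - S f \<sigma>) - 1)\<close>, so the claim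
  amounts to \<open>S f (\<sigma>\<^sup>i) - S f \<sigma> = (D f) (\<tau>\<^sub>i \<sigma>)\<close> for every site \<open>i\<close>.

  There are two reasons for this identity.  The operator \<open>D\<close> is the change of \<open>S\<close> under a flip at
  the origin, \<open>D g \<eta> = S g (\<eta>\<^sup>0) - S g \<eta>\<close> (lemma \<open>D_op_eq_shift_sum_diff\<close>): by linearity it
  is enough to see this for \<open>g = H\<^sub>A\<close>, whose shift by \<open>r\<close> is \<open>H\<^sub>A\<^sub>+\<^sub>r\<close> and changes sign under
  the flip exactly when \<open>0 \<in> A + r\<close>, that is, when \<open>r \<in> -A\<close>.  Moreover \<open>S g\<close> is shift
  invariant, and shifting by \<open>i\<close> carries a flip at \<open>i\<close> to a flip at the origin, so that the
  flip at \<open>i\<close> changes \<open>S\<close> by the value of \<open>D\<close> at \<open>\<tau>\<^sub>i \<sigma>\<close> (lemma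
  \<open>shift_sum_flip_diff\<close>).
\<close>

definition shift_sum ::
  "nat \<Rightarrow> ((int ^ 'd \<Rightarrow> real) \<Rightarrow> real) \<Rightarrow> (int ^ 'd \<Rightarrow> real) \<Rightarrow> real" where
  "shift_sum N g \<eta> = (\<Sum>i\<in>torus N. g (tshift N i \<eta>))"

lemma card_torus_pos: "0 < card (torus N :: (int ^ 'd) set)"
  using zero_in_torus finite_torus by (auto simp: card_gt_0_iff)

lemma card_times_pairing_empirical:
  fixes \<eta> :: "int ^ 'd \<Rightarrow> real"
  shows "real (card (torus N :: (int ^ 'd) set)) * pairing g (empirical N \<eta>) = shift_sum N g \<eta>"
  using card_torus_pos[where 'd = 'd, of N] by (simp add: pairing_empirical shift_sum_def)

lemma tadd_assoc: "tadd N (tadd N x y) z = tadd N x (tadd N y z)"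
proof -
  have "(((a + b + n) mod m - n) + c + n) mod m = (a + ((b + c + n) mod m - n) + n) mod m"
    for a b c n m :: int
  proof -
    have "((a + b + n) mod m + c) mod m = (a + (b + c + n) mod m) mod m"
      by (simp add: mod_add_left_eq mod_add_right_eq ac_simps)
    thus ?thesis by simp
  qed
  thus ?thesis by (simp add: tadd_def vec_eq_iff)
qed

lemma bij_betw_tadd: "bij_betw (tadd N i) (torus N) (torus N)"
proof -
  have "tadd N i = (\<lambda>a. tadd N a i)"
    by (rule ext) (rule tadd_commute)
  hence inj: "inj_on (tadd N i) (torus N)"
    by (simp only: tadd_inj_on)
  moreover have "tadd N i ` torus N = torus N"
    by (rule endo_inj_surj[OF finite_torus _ inj]) (auto simp: tadd_in_torus)
  ultimately show ?thesis by (simp add: bij_betw_def)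
qed

lemma tshift_tshift: "tshift N j (tshift N i \<eta>) = tshift N (tadd N i j) \<eta>"
  by (auto simp: tshift_def tadd_in_torus tadd_assoc intro!: restrict_ext)

lemma shift_sum_tshift: "shift_sum N g (tshift N i \<eta>) = shift_sum N g \<eta>"
  unfolding shift_sum_def tshift_tshift
  by (rule sum.reindex_bij_betw[OF bij_betw_tadd])

lemma tadd_eq_self_iff:
  assumes "i \<in> torus N" "j \<in> torus N"
  shows "tadd N i j = i \<longleftrightarrow> j = 0"
proof -
  have "tadd N i 0 = i"
  proof -
    have "(a + int N) mod (2 * int N + 1) = a + int N" if "- int N \<le> a" "a \<le> int N" for a
      using that by (intro mod_pos_pos_trivial) auto
    thus ?thesis
      using assms(1) by (auto simp only: tadd_def torus_def vec_eq_iff vec_lambda_beta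
          zero_index add_0_right mem_Collect_eq atLeastAtMost_iff)
  qed
  thus ?thesis
    using bij_betw_imp_inj_on[OF bij_betw_tadd, of N i] assms(2) zero_in_torus
    by (metis inj_onD)
qed

lemma tshift_flip:
  assumes "i \<in> torus N"
  shows "tshift N i (flip i \<sigma>) = flip 0 (tshift N i \<sigma>)"
proof
  fix j show "tshift N i (flip i \<sigma>) j = flip 0 (tshift N i \<sigma>) j"
    using tadd_eq_self_iff[OF assms, of j] zero_in_torus[of N]
    by (auto simp: tshift_def flip_def)
qed

text \<open>Flipping at \<open>i\<close> and then shifting by \<open>i\<close> flips the origin of the shifted configuration,
  and \<open>shift_sum\<close> cannot see the shift.  This reduces flips at all sites to the origin.\<close>

lemma shift_sum_flip_diff:
  assumes "i \<in> torus N"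
  shows "shift_sum N g (flip i \<sigma>) - shift_sum N g \<sigma> =
    shift_sum N g (flip 0 (tshift N i \<sigma>)) - shift_sum N g (tshift N i \<sigma>)"
  by (simp add: tshift_flip[OF assms, symmetric] shift_sum_tshift)

lemma H_tshift:
  assumes "A \<subseteq> torus N" "\<eta> \<in> OmegaN N"
  shows "H N A (tshift N r \<eta>) = H N ((\<lambda>a. tadd N a r) ` A) \<eta>"
proof -
  have "H N A (tshift N r \<eta>) = (\<Prod>a\<in>A. \<eta> (tadd N a r))"
    unfolding H_apply[OF tshift_OmegaN[OF assms(2)]]
    by (rule prod.cong) (use assms(1) tshift_apply tadd_commute in \<open>metis subsetD\<close>)+
  thus ?thesis
    by (simp add: H_apply[OF assms(2)] prod.reindex[OF inj_on_subset[OF tadd_inj_on assms(1)]])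
qed

lemma H_flip:
  assumes "finite B" "i \<in> torus N" "\<eta> \<in> OmegaN N"
  shows "H N B (flip i \<eta>) = (if i \<in> B then -1 else 1) * H N B \<eta>"
proof -
  have "H N B (flip i \<eta>) = (\<Prod>b\<in>B. (if b = i then -1 else 1) * \<eta> b)"
    unfolding H_apply[OF flip_OmegaN[OF assms(2,3)]]
    by (intro prod.cong) (auto simp: flip_def)
  thus ?thesis
    using assms(1) by (simp add: prod.distrib prod.delta H_apply[OF assms(3)])
qed

text \<open>Among the shifts \<open>H\<^sub>A\<^sub>+\<^sub>r\<close> only those with \<open>0 \<in> A + r\<close> react to a flip at the origin,
  and each of them loses twice its value.  This is the origin of the index set \<open>-A\<close> and of
  the factor \<open>-2\<close>.\<close>

lemma shift_sum_H_flip_diff: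
  fixes A :: "(int ^ 'd) set"
  assumes A: "A \<subseteq> torus N" and \<eta>: "\<eta> \<in> OmegaN N"
  shows "shift_sum N (H N A) (flip 0 \<eta>) - shift_sum N (H N A) \<eta> =
    (\<Sum>r\<in>uminus ` A. (-2) * H N ((\<lambda>a. tadd N a r) ` A) \<eta>)"
proof -
  let ?B = "\<lambda>r. (\<lambda>a. tadd N a r) ` A"
  have fA: "finite A" using A finite_torus finite_subset by blast
  have "0 \<in> ?B r \<longleftrightarrow> r \<in> uminus ` A" if "r \<in> torus N" for r
  proof -
    have "tadd N a r = 0 \<longleftrightarrow> r = - a" if "a \<in> A" for a
      using tadd_eq_0_iff[of a N r] A that \<open>r \<in> torus N\<close> by (auto simp: tadd_commute)
    thus ?thesis by (force simp: image_iff)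
  qed
  hence "H N A (tshift N r (flip 0 \<eta>)) - H N A (tshift N r \<eta>) =
      (if r \<in> uminus ` A then (-2) * H N (?B r) \<eta> else 0)" if "r \<in> torus N" for r
    using that fA
    by (simp add: H_tshift[OF A] flip_OmegaN[OF zero_in_torus \<eta>] \<eta> H_flip[OF _ zero_in_torus \<eta>])
  hence "shift_sum N (H N A) (flip 0 \<eta>) - shift_sum N (H N A) \<eta> =
      (\<Sum>r\<in>torus N. if r \<in> uminus ` A then (-2) * H N (?B r) \<eta> else 0)"
    unfolding shift_sum_def sum_subtractf[symmetric] by (intro sum.cong) auto
  also have "\<dots> = (\<Sum>r\<in>torus N \<inter> uminus ` A. (-2) * H N (?B r) \<eta>)"
    by (rule sum.inter_restrict[OF finite_torus, symmetric])
  also have "torus N \<inter> uminus ` A = uminus ` A" using A uminus_torus by auto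
  finally show ?thesis .
qed

text \<open>Both sides are linear in \<open>g\<close>, and the functions \<open>H\<^sub>A\<close> span, so this follows from the case
  \<open>g = H\<^sub>A\<close>.  In this form \<open>D\<close> can be evaluated at functions whose coefficients in the
  basis \<open>H\<^sub>A\<close> are unknown.\<close>

lemma D_op_eq_shift_sum_diff:
  fixes g :: "(int ^ 'd \<Rightarrow> real) \<Rightarrow> real"
  assumes g: "g \<in> funsN N" and \<eta>: "\<eta> \<in> OmegaN N"
  shows "D_op N g \<eta> = shift_sum N g (flip 0 \<eta>) - shift_sum N g \<eta>"
proof -
  let ?P = "Pow (torus N :: (int ^ 'd) set)"
  obtain b where b: "g = (\<lambda>\<sigma>\<in>OmegaN N. \<Sum>A\<in>?P. b A * H N A \<sigma>)"
    using H_span[OF g] .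
  have lin: "linear_op N (D_op N :: ((int ^ 'd \<Rightarrow> real) \<Rightarrow> real) \<Rightarrow> _)"
    and DH: "\<And>A. A \<in> ?P \<Longrightarrow> D_op N (H N A) =
      (\<lambda>\<sigma>\<in>OmegaN N. \<Sum>r\<in>uminus ` A. (-2) * H N ((\<lambda>a. tadd N a r) ` A) \<sigma>)"
    using is_D_op_D_op[of N] by (auto simp: is_D_op_def)
  have expand: "shift_sum N g \<xi> = (\<Sum>A\<in>?P. b A * shift_sum N (H N A) \<xi>)"
    if "\<xi> \<in> OmegaN N" for \<xi>
  proof -
    have "shift_sum N g \<xi> = (\<Sum>i\<in>torus N. \<Sum>A\<in>?P. b A * H N A (tshift N i \<xi>))"
      unfolding shift_sum_def by (simp add: b tshift_OmegaN[OF that])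
    thus ?thesis
      by (subst (asm) sum.swap) (simp add: shift_sum_def sum_distrib_left)
  qed
  have "D_op N g = (\<lambda>\<sigma>\<in>OmegaN N. \<Sum>A\<in>?P. b A * D_op N (H N A) \<sigma>)"
    unfolding b by (rule linear_op_sum[OF lin]) (auto simp: finite_torus H_in_funsN)
  hence "D_op N g \<eta> = (\<Sum>A\<in>?P. b A * D_op N (H N A) \<eta>)"
    using \<eta> by simp
  also have "\<dots> =
      (\<Sum>A\<in>?P. b A * (shift_sum N (H N A) (flip 0 \<eta>) - shift_sum N (H N A) \<eta>))"
    using \<eta> by (intro sum.cong) (auto simp: DH shift_sum_H_flip_diff)
  also have "\<dots> = shift_sum N g (flip 0 \<eta>) - shift_sum N g \<eta>"
    by (simp add: expand[OF \<eta>] expand[OF flip_OmegaN[OF zero_in_torus \<eta>]]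
        right_diff_distrib sum_subtractf)
  finally show ?thesis .
qed

theorem theorem1:
  fixes c f :: "(int ^ 'd \<Rightarrow> real) \<Rightarrow> real"
  assumes "is_local c" and "\<forall>\<sigma>\<in>Omega. 0 < c \<sigma>"
    and "is_local f"
  shows "\<forall>\<^sub>F N in sequentially. \<forall>\<sigma>\<in>OmegaN N.
    1 / real (card (torus N :: (int ^ 'd) set))
      * exp (- real (card (torus N :: (int ^ 'd) set)) * pairing (on_torus N f) (empirical N \<sigma>))
      * generator c N
          (\<lambda>\<eta>\<in>OmegaN N. exp (real (card (torus N :: (int ^ 'd) set))
             * pairing (on_torus N f) (empirical N \<eta>))) \<sigma>
    = pairing (\<lambda>\<eta>\<in>OmegaN N. on_torus N c \<eta> * (exp (D_op N (on_torus N f) \<eta>) - 1))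
        (empirical N \<sigma>)"
proof (intro always_eventually allI ballI)
  fix N and \<sigma> :: "int ^ 'd \<Rightarrow> real"
  assume \<sigma>: "\<sigma> \<in> OmegaN N"
  let ?T = "torus N :: (int ^ 'd) set"
  let ?F = "on_torus N f"
  let ?S = "shift_sum N ?F"
  have F: "?F \<in> funsN N" by (simp add: on_torus_def)
  have D: "D_op N ?F (tshift N i \<sigma>) = ?S (flip i \<sigma>) - ?S \<sigma>" if "i \<in> ?T" for i
    using D_op_eq_shift_sum_diff[OF F tshift_OmegaN[OF \<sigma>]] shift_sum_flip_diff[OF that]
    by metis
  have "exp (- ?S \<sigma>) * generator c N (\<lambda>\<eta>\<in>OmegaN N. exp (?S \<eta>)) \<sigma> =
      (\<Sum>i\<in>?T. on_torus N c (tshift N i \<sigma>) * (exp (- ?S \<sigma>) * (exp (?S (flip i \<sigma>)) - exp (?S \<sigma>))))"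
    using \<sigma> by (auto simp: generator_def flip_OmegaN sum_distrib_left mult_ac intro!: sum.cong)
  also have "\<dots> =
      (\<Sum>i\<in>?T. on_torus N c (tshift N i \<sigma>) * (exp (D_op N ?F (tshift N i \<sigma>)) - 1))"
    by (intro sum.cong) (auto simp: D exp_diff exp_minus field_simps)
  also have "\<dots> = real (card ?T) *
      pairing (\<lambda>\<eta>\<in>OmegaN N. on_torus N c \<eta> * (exp (D_op N ?F \<eta>) - 1)) (empirical N \<sigma>)"
    unfolding card_times_pairing_empirical by (simp add: shift_sum_def tshift_OmegaN[OF \<sigma>])
  finally show "1 / real (card ?T) * exp (- real (card ?T) * pairing ?F (empirical N \<sigma>))
      * generator c N (\<lambda>\<eta>\<in>OmegaN N. exp (real (card ?T) * pairing ?F (empirical N \<eta>))) \<sigma>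
    = pairing (\<lambda>\<eta>\<in>OmegaN N. on_torus N c \<eta> * (exp (D_op N ?F \<eta>) - 1)) (empirical N \<sigma>)"
    using card_torus_pos[where 'd = 'd, of N]
    by (simp add: card_times_pairing_empirical[of N ?F] field_simps)
qed

end
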